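(* Let $d$ be a positive integer and let $G$ be a triangle-free $4$-sunspot-free graph of minimum degree at least $4d-1$ that is both liberal and flapless. Let $H$ be a hole of length at least $6$ in $G$. Then there is a full $d$-safe $H$-flare in $G$.
   Context: Graphs are finite and simple. A $4$-sunspot in $G$ is a $7$-tuple $(x_1,x_2,x_3,x_4;y_1,y_2,y_3)$ of pairwise distinct vertices such that the edges of $G$ among them are exactly $x_1x_2,x_2x_3,x_3x_4,x_4x_1,x_1y_1,x_2y_2,x_3y_3$; $G$ is $4$-sunspot-free if none exists. A hole is an induced cycle on at least four vertices, its length being its number of edges. For a hole $H$, an $H$-flap is a hole of length $4$ sharing at least one edge with $H$. $G$ is liberal if for all distinct non-adjacent vertices $x,y$, both $N(x)\setminus N(y)$ and $N(y)\setminus N(x)$ are nonempty; $G$ is flapless if for every hole $H$ of length at least $6$ there is no $H$-flap. Sets $X,Y$ are anticomplete if they are disjoint and there is no edge between them. For a hole $H$, an $H$-flare is a map $\Phi$ from $V(H)$ to subsets of $V(G)\setminus V(H)$ with $\Phi(h)\subseteq N_G(h)\setminus V(H)$ and $|\Phi(h)|\leq 1$ for all $h$; write $\Phi[h]=\Phi(h)\cup\{h\}$. $\Phi$ is full if $|\Phi(h)|=1$ for every $h\in V(H)$, and $d$-safe if for all $h,h'\in V(H)$ at distance at most $d$ in $H$, the sets $\Phi(h)$ and $\Phi[h']$ are anticomplete.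
   Formalization: In the definition of d-safe, h and h' are required to be distinct; with h = h' (distance 0) the condition would force Φ(h) to be empty, so no full flare could be d-safe. *)

theory Defs
  imports "Graph_Theory.Graph_Theory"
begin

text \<open>
  Finite simple graphs are the finite, loop-free, symmetric digraphs without parallel arcs of
  the locale \<^locale>\<open>graph\<close>, where an edge is a pair of opposite arcs. An undirected
  edge is recorded as the set of its two ends.
\<close>

definition edges :: "('a, 'b) pre_digraph \<Rightarrow> 'a set set" where
  "edges G = {{u, v} | u v. u \<rightarrow>\<^bsub>G\<^esub> v}"

definition nbhd :: "('a, 'b) pre_digraph \<Rightarrow> 'a \<Rightarrow> 'a set" where
  "nbhd G v = {w. v \<rightarrow>\<^bsub>G\<^esub> w}"

definition degree :: "('a, 'b) pre_digraph \<Rightarrow> 'a \<Rightarrow> nat" where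
  "degree G v = card (nbhd G v)"

definition anticomplete :: "('a, 'b) pre_digraph \<Rightarrow> 'a set \<Rightarrow> 'a set \<Rightarrow> bool" where
  "anticomplete G X Y \<longleftrightarrow> X \<inter> Y = {} \<and> (\<forall>x\<in>X. \<forall>y\<in>Y. {x, y} \<notin> edges G)"

definition triangle_free :: "('a, 'b) pre_digraph \<Rightarrow> bool" where
  "triangle_free G \<longleftrightarrow>
     \<not> (\<exists>x y z. distinct [x, y, z] \<and> {{x, y}, {y, z}, {z, x}} \<subseteq> edges G)"

definition sunspot4 ::
  "('a, 'b) pre_digraph \<Rightarrow> 'a \<Rightarrow> 'a \<Rightarrow> 'a \<Rightarrow> 'a \<Rightarrow> 'a \<Rightarrow> 'a \<Rightarrow> 'a \<Rightarrow> bool" where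
  "sunspot4 G x1 x2 x3 x4 y1 y2 y3 \<longleftrightarrow>
     distinct [x1, x2, x3, x4, y1, y2, y3] \<and>
     {x1, x2, x3, x4, y1, y2, y3} \<subseteq> verts G \<and>
     {e \<in> edges G. e \<subseteq> {x1, x2, x3, x4, y1, y2, y3}} =
       {{x1, x2}, {x2, x3}, {x3, x4}, {x4, x1}, {x1, y1}, {x2, y2}, {x3, y3}}"

definition sunspot4_free :: "('a, 'b) pre_digraph \<Rightarrow> bool" where
  "sunspot4_free G \<longleftrightarrow> \<not> (\<exists>x1 x2 x3 x4 y1 y2 y3. sunspot4 G x1 x2 x3 x4 y1 y2 y3)"

definition liberal :: "('a, 'b) pre_digraph \<Rightarrow> bool" where
  "liberal G \<longleftrightarrow>
     (\<forall>x\<in>verts G. \<forall>y\<in>verts G. x \<noteq> y \<and> {x, y} \<notin> edges G \<longrightarrow>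
        nbhd G x - nbhd G y \<noteq> {} \<and> nbhd G y - nbhd G x \<noteq> {})"

text \<open>
  The library's \<^const>\<open>pre_digraph.cycle\<close> is a closed arc walk, and in a symmetric
  digraph it may traverse an edge back and forth; here a cycle is a graph.
\<close>

definition cycle_graph :: "('a, 'b) pre_digraph \<Rightarrow> bool" where
  "cycle_graph C \<longleftrightarrow>
     (\<exists>vs. distinct vs \<and> length vs \<ge> 3 \<and> verts C = set vs \<and>
        edges C = {{vs ! i, vs ! (Suc i mod length vs)} | i. i < length vs})"

definition hole :: "('a, 'b) pre_digraph \<Rightarrow> ('a, 'b) pre_digraph \<Rightarrow> bool" where
  "hole G H \<longleftrightarrow> induced_subgraph H G \<and> cycle_graph H \<and> card (verts H) \<ge> 4"

definition hole_length :: "('a, 'b) pre_digraph \<Rightarrow> nat" where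
  "hole_length H = card (edges H)"

definition flap ::
  "('a, 'b) pre_digraph \<Rightarrow> ('a, 'b) pre_digraph \<Rightarrow> ('a, 'b) pre_digraph \<Rightarrow> bool" where
  "flap G H F \<longleftrightarrow> hole G F \<and> hole_length F = 4 \<and> edges F \<inter> edges H \<noteq> {}"

definition flapless :: "('a, 'b) pre_digraph \<Rightarrow> bool" where
  "flapless G \<longleftrightarrow> (\<forall>H. hole G H \<and> hole_length H \<ge> 6 \<longrightarrow> \<not> (\<exists>F. flap G H F))"

text \<open>Distance: minimum number of arcs on a walk, \<open>\<infinity>\<close> if there is none.\<close>

definition gdist :: "('a, 'b) pre_digraph \<Rightarrow> 'a \<Rightarrow> 'a \<Rightarrow> ereal" where
  "gdist G u v = wf_digraph.\<mu> G (\<lambda>_. 1) u v"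

text \<open>A flare is a total function, of which only the values on \<open>verts H\<close> matter.\<close>

definition flare ::
  "('a, 'b) pre_digraph \<Rightarrow> ('a, 'b) pre_digraph \<Rightarrow> ('a \<Rightarrow> 'a set) \<Rightarrow> bool" where
  "flare G H \<Phi> \<longleftrightarrow>
     (\<forall>h\<in>verts H. \<Phi> h \<subseteq> nbhd G h - verts H \<and> finite (\<Phi> h) \<and> card (\<Phi> h) \<le> 1)"

definition full_flare :: "('a, 'b) pre_digraph \<Rightarrow> ('a \<Rightarrow> 'a set) \<Rightarrow> bool" where
  "full_flare H \<Phi> \<longleftrightarrow> (\<forall>h\<in>verts H. card (\<Phi> h) = 1)"

text \<open>
  The vertices \<open>h\<close> and \<open>h'\<close> have to be distinct: \<open>\<Phi> h\<close> is contained in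
  \<open>insert h (\<Phi> h)\<close>, so a nonempty \<open>\<Phi> h\<close> is never anticomplete to that set.
\<close>

definition safe_flare ::
  "nat \<Rightarrow> ('a, 'b) pre_digraph \<Rightarrow> ('a, 'b) pre_digraph \<Rightarrow> ('a \<Rightarrow> 'a set) \<Rightarrow> bool" where
  "safe_flare d G H \<Phi> \<longleftrightarrow>
     (\<forall>h\<in>verts H. \<forall>h'\<in>verts H. h \<noteq> h' \<and> gdist H h h' \<le> ereal (real d) \<longrightarrow>
        anticomplete G (\<Phi> h) (insert h' (\<Phi> h')))"

end

theory Submission
  imports Defs
begin

text \<open>
  In a triangle-free flapless graph every 4-cycle is induced and contains no edge of \<open>H\<close>. If two
  non-adjacent vertices have two common neighbours, three vertices of the resulting 4-cycle, with
  private neighbours (which exist since \<open>G\<close> is liberal) or neighbours on \<open>H\<close> attached to them,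
  yield a 4-sunspot; so non-adjacent \<open>h, h'\<close> of \<open>H\<close> have at most one common neighbour outside
  \<open>H\<close>, and likewise \<open>h\<close> and the vertex chosen for \<open>h'\<close>. Hence, choosing the values of the
  flare one at a time, each of the at most \<open>2(d - 1)\<close> vertices \<open>h'\<close> at distance \<open>2, ..., d\<close> from
  \<open>h\<close> excludes at most two of the at least \<open>4d - 3\<close> neighbours of \<open>h\<close> outside \<open>H\<close>, while the
  neighbours of \<open>h\<close> in \<open>H\<close> exclude none: they would give a triangle or a flap.
\<close>

text \<open>
  \<open>E\<close> is the adjacency relation and \<open>S\<close> the vertex set of the hole. The assumptions
  \<open>no_sunspot\<close> and \<open>no_flap\<close> list only those non-adjacencies that do not already follow from
  \<open>no_triangle\<close>.
\<close>

locale sunspot_free_relation =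
  fixes V S :: "'a set" and E :: "'a \<Rightarrow> 'a \<Rightarrow> bool"
  assumes E_sym: "E x y \<Longrightarrow> E y x"
    and E_in: "E x y \<Longrightarrow> y \<in> V"
    and finite_V: "finite V"
    and S_sub: "S \<subseteq> V"
    and no_triangle: "\<lbrakk>E x y; E y z; E z x\<rbrakk> \<Longrightarrow> False"
    and no_sunspot: "\<lbrakk>E a b; E b c; E c d; E d a; a \<noteq> c; b \<noteq> d; E a p; E b q; E c r;
          \<not> E p q; \<not> E q r; \<not> E p r; \<not> E p c; \<not> E r a; \<not> E q d\<rbrakk> \<Longrightarrow> False"
    and private_neighbour: "\<lbrakk>x \<in> V; y \<in> V; x \<noteq> y; \<not> E x y\<rbrakk> \<Longrightarrow> \<exists>z. E x z \<and> \<not> E y z"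
    and two_regular: "h \<in> S \<Longrightarrow> \<exists>a b. a \<noteq> b \<and> {x \<in> S. E h x} = {a, b}"
    and no_flap: "\<lbrakk>a \<in> S; b \<in> S; E a b; E b c; E c e; E e a; a \<noteq> c; b \<noteq> e\<rbrakk> \<Longrightarrow> False"
begin

section \<open>Uniqueness of common neighbours outside the hole\<close>

text \<open>Otherwise \<open>h\<close>, \<open>x\<close>, \<open>h'\<close>, \<open>z\<close> form a
  4-cycle, which becomes a sunspot with pendants \<open>p\<close>, \<open>r\<close> on the hole at
  \<open>h\<close>, \<open>h'\<close> and a private neighbour \<open>q\<close> of \<open>x\<close>;
  \<open>z\<close> stays bare. \<open>no_flap\<close> removes the unwanted edges except
  \<open>p r\<close>, which two-regularity avoids, and \<open>q z\<close>, which the choice of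
  \<open>q\<close> avoids.\<close>

lemma common_neighbours_in_hole:
  assumes h: "h \<in> S" "h' \<in> S" "h \<noteq> h'" "\<not> E h h'"
    and x: "E h x" "E h' x" "x \<notin> S" and z: "E h z" "E h' z" "z \<notin> S"
  shows "x = z"
proof (rule ccontr)
  assume "x \<noteq> z"
  have disj: False if m: "m \<in> S" "E h m" "E h' m" for m
    using no_flap[of h m h' x] m h x E_sym by metis
  obtain a b where ab: "a \<noteq> b" "{u \<in> S. E h u} = {a, b}"
    using two_regular h(1) by blast
  obtain c e where ce: "c \<noteq> e" "{u \<in> S. E h' u} = {c, e}"
    using two_regular h(2) by blast
  have abS: "a \<in> S" "b \<in> S" "E h a" "E h b" using ab by auto
  have ceS: "c \<in> S" "e \<in> S" "E h' c" "E h' e" using ce by auto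
  \<comment> \<open>If \<open>a\<close> were adjacent to both hole neighbours of \<open>h'\<close>,
    it would have three neighbours \<open>h\<close>, \<open>c\<close>, \<open>e\<close> on the hole;
    otherwise \<open>p = a\<close> works.\<close>
  have "\<exists>p r. p \<in> S \<and> E h p \<and> r \<in> S \<and> E h' r \<and> \<not> E p r"
  proof (cases "E a c \<and> E a e")
    case True
    obtain s t where "{u \<in> S. E a u} = {s, t}"
      using two_regular abS by blast
    moreover have "h \<in> {u \<in> S. E a u}" "c \<in> {u \<in> S. E a u}" "e \<in> {u \<in> S. E a u}"
      using True h abS ceS E_sym by auto
    moreover have "h \<noteq> c" "h \<noteq> e" using h(4) ceS E_sym by auto
    ultimately show ?thesis using ce(1) by auto
  next
    case False
    then show ?thesis using abS ceS by blast
  qed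
  then obtain p r where pr: "p \<in> S" "E h p" "r \<in> S" "E h' r" "\<not> E p r" by blast
  have ph: "\<not> E p h'" "\<not> E r h" using disj pr E_sym by blast+
  have "\<not> E x z" using no_triangle x z E_sym by blast
  then obtain q where q: "E x q" "\<not> E z q"
    using private_neighbour[of x z] x z E_in \<open>x \<noteq> z\<close> by blast
  have ne: "h \<noteq> q" "h' \<noteq> q" using q z E_sym by blast+
  have "\<not> E p q" 
    using no_flap[of h p q x] h pr q x E_sym ne by blast
  moreover have "\<not> E q r"
    using no_flap[of h' r q x] h pr q x E_sym ne by blast
  ultimately show False
    using no_sunspot[of h x h' z p q r] h x z pr ph q E_sym \<open>x \<noteq> z\<close> by blast
qed

text \<open>Used with \<open>p\<close> the value already chosen for \<open>h'\<close>. The 4-cycle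
  is now \<open>h\<close>, \<open>x\<close>, \<open>p\<close>, \<open>z\<close>, and
  \<open>h'\<close> serves as the pendant at \<open>p\<close>. A private neighbour of
  \<open>x\<close> or \<open>z\<close> may be adjacent to \<open>h'\<close>; if both are, a rotated
  sunspot avoids \<open>h'\<close> altogether.\<close>

lemma common_neighbours_off_hole:
  assumes h: "h \<in> S" "h' \<in> S" "h \<noteq> h'" "\<not> E h h'"
    and p: "E h' p" "p \<notin> S" "\<not> E h p"
    and x: "E h x" "E p x" "x \<notin> S" and z: "E h z" "E p z" "z \<notin> S"
  shows "x = z"
proof (rule ccontr)
  assume "x \<noteq> z"
  obtain a b where ab: "a \<noteq> b" "{u \<in> S. E h u} = {a, b}"
    using two_regular h(1) by blast
  have abS: "a \<in> S" "b \<in> S" "E h a" "E h b" using ab by auto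
  \<comment> \<open>If both hole neighbours of \<open>h\<close> were adjacent to \<open>h'\<close>,
    then \<open>h\<close>, \<open>a\<close>, \<open>h'\<close>, \<open>b\<close> would be a 4-cycle
    through the hole edge \<open>h a\<close>.\<close>
  have "\<not> E a h' \<or> \<not> E b h'"
    using no_flap[of h a h' b] h abS ab E_sym by blast
  then obtain y where y: "y \<in> S" "E h y" "\<not> E y h'" using abS by blast
  have hp: "h \<noteq> p" using h p by blast
  have yp: "\<not> E y p"
    using no_flap[of h y p x] h y p x hp E_sym by blast
  have xz: "\<not> E x z" using no_triangle x z E_sym by blast
  obtain q where q: "E x q" "\<not> E z q"
    using private_neighbour[of x z] x z E_in \<open>x \<noteq> z\<close> xz by blast
  obtain r where r: "E z r" "\<not> E x r"
    using private_neighbour[of z x] x z E_in \<open>x \<noteq> z\<close> xz E_sym by blast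
  have ne: "h \<noteq> q" "h \<noteq> r" using q r x z E_sym by blast+
  have yq: "\<not> E y q" using no_flap[of h y q x] h y q x E_sym ne by blast
  have yr: "\<not> E y r" using no_flap[of h y r z] h y r z E_sym ne by blast
  \<comment> \<open>All other conditions for a sunspot with pendants \<open>y\<close>,
    \<open>q\<close>, \<open>h'\<close> hold, so only the edge \<open>q h'\<close> can spoil it;
    likewise for \<open>r\<close> with \<open>x\<close> and \<open>z\<close> exchanged.\<close>
  have "E q h'"
    using no_sunspot[of h x p z y q h'] h y yp yq x z p q hp \<open>x \<noteq> z\<close> E_sym by blast
  moreover have "E r h'"
    using no_sunspot[of h z p x y r h'] h y yp yr x z p r hp \<open>x \<noteq> z\<close> E_sym by blast
  \<comment> \<open>Now \<open>q\<close> and \<open>r\<close> have the common neighbour \<open>h'\<close>; shift the sunspot so that \<open>p\<close> is its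
    vertex without pendant edge.\<close>
  ultimately have "\<not> E q r" using no_triangle E_sym by blast
  then show False
    using no_sunspot[of x h z p q y r] x z q r y yp yq yr hp \<open>x \<noteq> z\<close> E_sym by blast
qed

section \<open>Greedy choice of the values of the flare\<close>

text \<open>Induction on \<open>T\<close>, with one new value per step. The condition on
  \<open>E h' (f h)\<close> ranges over all of \<open>S\<close> and not just \<open>T\<close>:
  \<open>common_neighbours_off_hole\<close> needs earlier values to be non-adjacent to the vertex
  that is treated next.\<close>

lemma greedy_choice:
  assumes near_sym: "\<And>h h'. near h h' \<Longrightarrow> near h' h"
    and near_card: "\<And>h. h \<in> S \<Longrightarrow>
      card {h' \<in> S. near h h' \<and> h' \<noteq> h \<and> \<not> E h h'} \<le> 2 * (d - 1)"
    and deg: "\<And>h. h \<in> S \<Longrightarrow> card {x. E h x} \<ge> 4 * d - 1" and d: "d \<ge> 1"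
    and T: "T \<subseteq> S"
  shows "\<exists>f. \<forall>h\<in>T. E h (f h) \<and> f h \<notin> S \<and>
    (\<forall>h'\<in>S. near h h' \<and> h' \<noteq> h \<longrightarrow> \<not> E h' (f h)) \<and>
    (\<forall>h'\<in>T. near h h' \<and> h' \<noteq> h \<longrightarrow> \<not> E (f h) (f h'))"
proof -
  have finS: "finite S" using S_sub finite_V finite_subset by blast
  have "finite T" using T finS finite_subset by blast
  then show ?thesis using T
  proof (induction T)
    case empty
    then show ?case by simp
  next
    case (insert h T)
    then obtain f where f: "\<And>g. g \<in> T \<Longrightarrow> E g (f g)" "\<And>g. g \<in> T \<Longrightarrow> f g \<notin> S"
      "\<And>g h'. \<lbrakk>g \<in> T; h' \<in> S; near g h'; h' \<noteq> g\<rbrakk> \<Longrightarrow> \<not> E h' (f g)"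
      "\<And>g h'. \<lbrakk>g \<in> T; h' \<in> T; near g h'; h' \<noteq> g\<rbrakk> \<Longrightarrow> \<not> E (f g) (f h')"
      by blast
    have hS: "h \<in> S" and TS: "T \<subseteq> S" using insert by auto
    \<comment> \<open>\<open>A h'\<close> holds the candidates at \<open>h\<close> excluded by
      \<open>h'\<close> itself, \<open>B h'\<close> those excluded by its value. The condition
      \<open>h' \<in> T\<close> makes \<open>B h'\<close> empty as long as \<open>h'\<close> has no
      value.\<close>
    define C where "C = {h' \<in> S. near h h' \<and> h' \<noteq> h \<and> \<not> E h h'}"
    define A where "A h' = {x. E h x \<and> E h' x \<and> x \<notin> S}" for h'
    define B where "B h' = {x. h' \<in> T \<and> E h x \<and> E (f h') x \<and> x \<notin> S}" for h'
    have fin: "finite {x. E h x}"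
      using finite_subset[OF _ finite_V] E_in by blast
    have le1: "finite X \<and> card X \<le> 1" if "\<And>x z. x \<in> X \<Longrightarrow> z \<in> X \<Longrightarrow> x = z" "X \<subseteq> {x. E h x}"
      for X
    proof
      show "finite X" using that(2) fin finite_subset by blast
      then show "card X \<le> 1" using that(1) by (simp add: card_le_Suc0_iff_eq)
    qed
    have A: "card (A g) \<le> 1" if "g \<in> C" for g
      using le1[of "A g"] common_neighbours_in_hole[of h g] that hS
      unfolding A_def C_def by blast
    have B: "card (B g) \<le> 1" if g: "g \<in> C" for g
    proof -
      have "x = z" if "x \<in> B g" "z \<in> B g" for x z
      proof -
        have "g \<in> T" using that by (simp add: B_def)
        moreover have "\<not> E h (f g)"
          using f(3)[OF \<open>g \<in> T\<close> hS] g near_sym unfolding C_def by blast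
        ultimately show ?thesis
          using common_neighbours_off_hole[of h g "f g" x z] that hS g f
          unfolding B_def C_def by blast
      qed
      then show ?thesis using le1[of "B g"] unfolding B_def by blast
    qed
    have finC: "finite C" using finS by (simp add: C_def)
    have "card (\<Union>g\<in>C. A g \<union> B g) \<le> (\<Sum>g\<in>C. card (A g \<union> B g))"
      using finC by (rule card_UN_le)
    also have "\<dots> \<le> (\<Sum>g\<in>C. 2)"
      by (rule sum_mono) (metis A B add_mono card_Un_le le_trans one_add_one)
    also have "\<dots> = 2 * card C" by simp
    also have "\<dots> \<le> 4 * d - 4" using near_card[OF hS] d unfolding C_def by auto
    finally have bad: "card (\<Union>g\<in>C. A g \<union> B g) \<le> 4 * d - 4" .
    \<comment> \<open>Exactly two neighbours of \<open>h\<close> lie on the hole, so at least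
      \<open>4 * d - 3\<close> candidates remain, one more than can be excluded.\<close>
    obtain a b where ab: "a \<noteq> b" "{x \<in> S. E h x} = {a, b}"
      using two_regular hS by blast
    have "card {x. E h x} = card ({x. E h x} \<inter> S) + card ({x. E h x} - S)"
      using card_Int_Diff[OF fin] .
    moreover have "{x. E h x} \<inter> S = {a, b}" using ab by blast
    ultimately have "card ({x. E h x} - S) \<ge> 4 * d - 3" using deg[OF hS] ab(1) by simp
    with bad d have lt: "card (\<Union>g\<in>C. A g \<union> B g) < card ({x. E h x} - S)" by linarith
    have "finite (\<Union>g\<in>C. A g \<union> B g)"
      by (rule finite_subset[OF _ fin]) (auto simp: A_def B_def)
    then have "\<not> {x. E h x} - S \<subseteq> (\<Union>g\<in>C. A g \<union> B g)"
      using lt card_mono by (metis not_le)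
    then obtain x where x: "E h x" "x \<notin> S" and xC: "\<And>g. g \<in> C \<Longrightarrow> x \<notin> A g \<and> x \<notin> B g"
      by blast
    \<comment> \<open>Hole neighbours \<open>g\<close> of \<open>h\<close> are not in
      \<open>C\<close>. For them an edge \<open>g x\<close> closes a triangle, and in
      \<open>x2\<close> an edge from \<open>f g\<close> to \<open>x\<close> closes the flap
      \<open>h\<close>, \<open>g\<close>, \<open>f g\<close>, \<open>x\<close>.\<close>
    have x1: "\<not> E g x" if g: "g \<in> S" "near h g" "g \<noteq> h" for g
    proof (cases "E h g")
      case True
      then show ?thesis using no_triangle x E_sym by blast
    next
      case False
      then show ?thesis using xC[of g] g x by (auto simp: A_def C_def)
    qed
    have x2: "\<not> E (f g) x" if g: "g \<in> T" "near h g" "g \<noteq> h" for g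
    proof (cases "E h g")
      case True
      have "h \<noteq> f g" "g \<noteq> x" using f(2) g(1) hS x TS by blast+
      then show ?thesis
        using no_flap[of h g "f g" x] f(1)[OF g(1)] hS g TS True x E_sym by blast
    next
      case False
      then show ?thesis using xC[of g] g TS x by (auto simp: B_def C_def)
    qed
    have "h \<notin> T" using insert by simp
    then have upd: "(f(h := x)) h = x" "\<And>g. g \<in> T \<Longrightarrow> (f(h := x)) g = f g" by auto
    show ?case
    proof (intro exI ballI conjI impI)
      fix g assume g: "g \<in> insert h T"
      show "E g ((f(h := x)) g)" "(f(h := x)) g \<notin> S"
        using g upd f x by auto
      show "\<not> E h' ((f(h := x)) g)" if "h' \<in> S" "near g h' \<and> h' \<noteq> g" for h'
        using g that upd f(3)[of g h'] x1[of h'] by auto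
      show "\<not> E ((f(h := x)) g) ((f(h := x)) h')" if "h' \<in> insert h T" "near g h' \<and> h' \<noteq> g" for h'
      proof (cases "g = h")
        case True
        then have "h' \<in> T" "near h h'" "h' \<noteq> h" using that by auto
        then show ?thesis using x2[of h'] E_sym[of x "f h'"] upd True by auto
      next
        case False
        then have "g \<in> T" "near h' g" using g that near_sym by auto
        then show ?thesis using x2[of g] f(4)[of g h'] that upd False by (cases "h' = h") auto
      qed
    qed
  qed
qed

end

section \<open>Edges and adjacency in symmetric digraphs\<close>

lemma edge_iff:
  assumes "symmetric G"
  shows "{u, v} \<in> edges G \<longleftrightarrow> u \<rightarrow>\<^bsub>G\<^esub> v"
  unfolding edges_def mem_Collect_eq doubleton_eq_iff
  using arcs_ends_symmetric[OF assms] by blast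

lemma (in graph) triangle_freeD:
  assumes "triangle_free G" and xyz: "x \<rightarrow>\<^bsub>G\<^esub> y" "y \<rightarrow>\<^bsub>G\<^esub> z" "z \<rightarrow>\<^bsub>G\<^esub> x"
  shows False
proof -
  have "distinct [x, y, z]" using xyz adj_not_same by auto
  then show False
    using \<open>triangle_free G\<close> xyz unfolding triangle_free_def by (auto simp: edge_iff[OF sym_arcs])
qed

lemma induced_subgraph_adj_iff:
  assumes "induced_subgraph H G"
  shows "u \<rightarrow>\<^bsub>H\<^esub> v \<longleftrightarrow> u \<in> verts H \<and> v \<in> verts H \<and> u \<rightarrow>\<^bsub>G\<^esub> v"
proof
  have sub: "subgraph H G" and arcs: "arcs H = {e \<in> arcs G. tail G e \<in> verts H \<and> head G e \<in> verts H}"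
    using assms by (auto simp: induced_subgraph_def)
  show "u \<in> verts H \<and> v \<in> verts H \<and> u \<rightarrow>\<^bsub>G\<^esub> v" if "u \<rightarrow>\<^bsub>H\<^esub> v"
    using that wf_digraph.adj_in_verts[of H] sub arcs_ends_mono[OF sub] by blast
  have ends: "tail H = tail G" "head H = head G"
    using sub by (auto simp: subgraph_def compatible_def)
  assume uv: "u \<in> verts H \<and> v \<in> verts H \<and> u \<rightarrow>\<^bsub>G\<^esub> v"
  then obtain e where "e \<in> arcs G" "tail G e = u" "head G e = v" by blast
  with uv arcs have "e \<in> arcs H" by simp
  with \<open>tail G e = u\<close> \<open>head G e = v\<close> show "u \<rightarrow>\<^bsub>H\<^esub> v"
    by (auto simp: arcs_ends_conv ends image_iff)
qed

section \<open>Winding the integers around a cycle\<close>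

text \<open>Indexing by all integers with period \<open>n\<close>, rather than by list positions,
  avoids a wrap-around case for neighbours and lets distances be compared with differences of
  indices.\<close>

lemma cycle_graph_winding:
  assumes "cycle_graph H" "symmetric H"
  shows "\<exists>(n::int) w. n \<ge> 3 \<and> range w = verts H \<and>
    (\<forall>t s. w t = w s \<longleftrightarrow> t mod n = s mod n) \<and>
    (\<forall>t v. w t \<rightarrow>\<^bsub>H\<^esub> v \<longleftrightarrow> v = w (t + 1) \<or> v = w (t - 1))"
proof -
  obtain vs where vs: "distinct vs" "length vs \<ge> 3" "verts H = set vs"
    "edges H = {{vs ! i, vs ! (Suc i mod length vs)} | i. i < length vs}"
    using assms(1) unfolding cycle_graph_def by blast
  define n where "n = int (length vs)"
  define w where "w t = vs ! nat (t mod n)" for t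
  have n3: "n \<ge> 3" using vs n_def by simp
  have idx: "nat (t mod n) < length vs" for t
    using pos_mod_bound[of n t] n3 unfolding n_def by linarith
  have eq: "w t = w s \<longleftrightarrow> t mod n = s mod n" for t s
  proof -
    have "w t = w s \<longleftrightarrow> nat (t mod n) = nat (s mod n)"
      unfolding w_def using nth_eq_iff_index_eq[OF vs(1) idx idx] .
    then show ?thesis using n3 by (auto simp: nat_eq_iff)
  qed
  have w_int: "w (int i) = vs ! i" if "i < length vs" for i
    using that by (simp add: w_def n_def)
  have w_Suc: "w (int i + 1) = vs ! (Suc i mod length vs)" for i
    by (simp add: w_def n_def add.commute nat_mod_distrib flip: of_nat_Suc)
  have range: "range w = verts H"
  proof
    show "range w \<subseteq> verts H" using idx by (auto simp: w_def vs(3))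
    show "verts H \<subseteq> range w"
      using w_int by (metis vs(3) in_set_conv_nth rangeI subsetI)
  qed
  have edges: "edges H = {{w t, w (t + 1)} | t. True}"
  proof
    show "edges H \<subseteq> {{w t, w (t + 1)} | t. True}"
    proof
      fix e assume "e \<in> edges H"
      then obtain i where "i < length vs" "e = {vs ! i, vs ! (Suc i mod length vs)}"
        unfolding vs(4) by blast
      then have "e = {w (int i), w (int i + 1)}" by (simp only: w_int w_Suc)
      then show "e \<in> {{w t, w (t + 1)} | t. True}" by blast
    qed
    show "{{w t, w (t + 1)} | t. True} \<subseteq> edges H"
    proof clarify
      fix t
      let ?i = "nat (t mod n)"
      have i: "int ?i = t mod n" using n3 by simp
      have "w t = w (int ?i)" "w (t + 1) = w (int ?i + 1)"
        unfolding eq i by (simp_all add: mod_simps)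
      then have "{w t, w (t + 1)} = {vs ! ?i, vs ! (Suc ?i mod length vs)}"
        by (simp only: w_int[OF idx] w_Suc)
      then show "{w t, w (t + 1)} \<in> edges H" unfolding vs(4) using idx by blast
    qed
  qed
  \<comment> \<open>Moves an edge found at some index \<open>s\<close> to the given index
    \<open>t\<close> of the same vertex.\<close>
  have shift: "w (t + k) = w (s + k)" if "w t = w s" for t s k
    using that unfolding eq by (rule mod_add_cong) simp
  have "w t \<rightarrow>\<^bsub>H\<^esub> v \<longleftrightarrow> v = w (t + 1) \<or> v = w (t - 1)" for t v
  proof -
    have "w t \<rightarrow>\<^bsub>H\<^esub> v \<longleftrightarrow> (\<exists>s. {w t, v} = {w s, w (s + 1)})"
      using edge_iff[OF assms(2), of "w t" v] edges by auto
    also have "\<dots> \<longleftrightarrow> v = w (t + 1) \<or> v = w (t - 1)"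
    proof
      assume "\<exists>s. {w t, v} = {w s, w (s + 1)}"
      then obtain s where "w t = w s \<and> v = w (s + 1) \<or> w t = w (s + 1) \<and> v = w s"
        by (auto simp: doubleton_eq_iff)
      then show "v = w (t + 1) \<or> v = w (t - 1)"
        using shift[of t s 1] shift[of t "s + 1" "-1"] by auto
    next
      assume "v = w (t + 1) \<or> v = w (t - 1)"
      then show "\<exists>s. {w t, v} = {w s, w (s + 1)}"
      proof
        assume "v = w (t - 1)"
        then have "{w t, v} = {w (t - 1), w (t - 1 + 1)}" by auto
        then show ?thesis by blast
      qed blast
    qed
    finally show ?thesis .
  qed
  with n3 range eq show ?thesis by blast
qed

lemma (in wf_digraph) gdist_le_imp_awalk:
  assumes "gdist G u v \<le> ereal (real d)"
  obtains p where "awalk u p v" "length p \<le> d"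
proof -
  \<comment> \<open>The strict bound \<open>d + 1\<close> yields a walk without showing that the
    infimum is attained; costs are whole numbers, so a cost below \<open>d + 1\<close> means at most
    \<open>d\<close> arcs.\<close>
  have "(INF p\<in>{p. awalk u p v}. ereal (awalk_cost (\<lambda>_. 1) p)) < ereal (real d + 1)"
    using assms unfolding gdist_def \<mu>_def by (rule le_less_trans) simp
  then obtain p where p: "awalk u p v" "ereal (awalk_cost (\<lambda>_. 1) p) < ereal (real d + 1)"
    unfolding INF_less_iff by blast
  moreover have "awalk_cost (\<lambda>_. 1) p = real (length p)"
    by (induction p) auto
  ultimately show ?thesis using that by fastforce
qed

text \<open>The walk lifts to the integers from any index \<open>t\<close> of its start, each arc
  changing the index by one.\<close>

lemma (in wf_digraph) awalk_winding:
  assumes "\<And>t v. w t \<rightarrow>\<^bsub>G\<^esub> v \<Longrightarrow> v = w (t + 1) \<or> v = w (t - 1 :: int)"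
    and "awalk (w t) p v"
  shows "\<exists>s. v = w s \<and> \<bar>s - t\<bar> \<le> int (length p)"
  using assms(2)
proof (induction p arbitrary: t)
  case Nil
  then have "v = w t" by (simp add: awalk_Nil_iff)
  then show ?case by (intro exI[of _ t]) simp
next
  case (Cons e p)
  have e: "w t \<rightarrow>\<^bsub>G\<^esub> head G e" "awalk (head G e) p v"
    using Cons.prems by (auto simp: awalk_Cons_iff dest: in_arcs_imp_in_arcs_ends)
  obtain r where r: "head G e = w r" "\<bar>r - t\<bar> = 1"
    using assms(1)[OF e(1)] that[of "t + 1"] that[of "t - 1"] by fastforce
  then obtain s where s: "v = w s" "\<bar>s - r\<bar> \<le> int (length p)" using Cons.IH e(2) by metis
  have "\<bar>s - t\<bar> \<le> int (length (e # p))" using r(2) s(2) by simp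
  then show ?case using s(1) by blast
qed

section \<open>Sunspots and holes built on 4-cycles\<close>

text \<open>Of the 21 pairs among the seven vertices, seven are the required edges, six are
  non-adjacent by hypothesis, and the other eight have a common neighbour, so an edge would close a
  triangle.\<close>

lemma (in graph) sunspot4I:
  assumes tf: "triangle_free G"
    and e: "a \<rightarrow>\<^bsub>G\<^esub> b" "b \<rightarrow>\<^bsub>G\<^esub> c" "c \<rightarrow>\<^bsub>G\<^esub> d" "d \<rightarrow>\<^bsub>G\<^esub> a"
      "a \<rightarrow>\<^bsub>G\<^esub> p" "b \<rightarrow>\<^bsub>G\<^esub> q" "c \<rightarrow>\<^bsub>G\<^esub> r" and ne: "a \<noteq> c" "b \<noteq> d"
    and n: "\<not> p \<rightarrow>\<^bsub>G\<^esub> q" "\<not> q \<rightarrow>\<^bsub>G\<^esub> r" "\<not> p \<rightarrow>\<^bsub>G\<^esub> r" "\<not> p \<rightarrow>\<^bsub>G\<^esub> c" "\<not> r \<rightarrow>\<^bsub>G\<^esub> a" "\<not> q \<rightarrow>\<^bsub>G\<^esub> d"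
  shows "sunspot4 G a b c d p q r"
proof -
  have sym: "u \<rightarrow>\<^bsub>G\<^esub> v \<Longrightarrow> v \<rightarrow>\<^bsub>G\<^esub> u" for u v using arcs_ends_symmetric[OF sym_arcs] .
  have irr: "\<not> u \<rightarrow>\<^bsub>G\<^esub> u" for u using adj_not_same by blast
  note tri = triangle_freeD[OF tf]
  have n': "\<not> a \<rightarrow>\<^bsub>G\<^esub> c" "\<not> b \<rightarrow>\<^bsub>G\<^esub> d" "\<not> p \<rightarrow>\<^bsub>G\<^esub> b" "\<not> p \<rightarrow>\<^bsub>G\<^esub> d" "\<not> q \<rightarrow>\<^bsub>G\<^esub> a" "\<not> q \<rightarrow>\<^bsub>G\<^esub> c"
      "\<not> r \<rightarrow>\<^bsub>G\<^esub> b" "\<not> r \<rightarrow>\<^bsub>G\<^esub> d"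
    using tri e sym by blast+
  have N2: "\<not> q \<rightarrow>\<^bsub>G\<^esub> p" "\<not> r \<rightarrow>\<^bsub>G\<^esub> q" "\<not> r \<rightarrow>\<^bsub>G\<^esub> p" "\<not> c \<rightarrow>\<^bsub>G\<^esub> p" "\<not> a \<rightarrow>\<^bsub>G\<^esub> r" "\<not> d \<rightarrow>\<^bsub>G\<^esub> q"
    "\<not> c \<rightarrow>\<^bsub>G\<^esub> a" "\<not> d \<rightarrow>\<^bsub>G\<^esub> b" "\<not> b \<rightarrow>\<^bsub>G\<^esub> p" "\<not> d \<rightarrow>\<^bsub>G\<^esub> p" "\<not> a \<rightarrow>\<^bsub>G\<^esub> q" "\<not> c \<rightarrow>\<^bsub>G\<^esub> q" "\<not> b \<rightarrow>\<^bsub>G\<^esub> r" "\<not> d \<rightarrow>\<^bsub>G\<^esub> r"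
    using n n' sym by blast+
  \<comment> \<open>Apart from the pairs in \<open>ne\<close>, any two non-adjacent vertices are
    told apart by a third one adjacent to exactly one of them.\<close>
  have dist: "distinct [a, b, c, d, p, q, r]"
    using e ne n n' N2 irr by auto
  have verts: "{a, b, c, d, p, q, r} \<subseteq> verts G" using e adj_in_verts by blast
  let ?X = "{a, b, c, d, p, q, r}"
  let ?R = "{{a, b}, {b, c}, {c, d}, {d, a}, {a, p}, {b, q}, {c, r}}"
  have "{e \<in> edges G. e \<subseteq> ?X} \<subseteq> ?R"
  proof
    fix e' assume "e' \<in> {e \<in> edges G. e \<subseteq> ?X}"
    then have "e' \<in> edges G" and sub: "e' \<subseteq> ?X" by auto
    then obtain u v where uv: "e' = {u, v}" "u \<rightarrow>\<^bsub>G\<^esub> v" by (auto simp: edges_def)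
    have u: "u \<in> ?X" and v: "v \<in> ?X" using sub uv by auto
    from u have "u = a \<and> v \<in> {b, d, p} \<or> u = b \<and> v \<in> {a, c, q} \<or> u = c \<and> v \<in> {b, d, r} \<or>
        u = d \<and> v \<in> {a, c} \<or> u = p \<and> v = a \<or> u = q \<and> v = b \<or> u = r \<and> v = c"
    proof (elim insertE emptyE)
      assume "u = a"
      then have "v \<in> {b, d, p}" using v uv(2) n' N2 irr by blast
      with \<open>u = a\<close> show ?thesis by blast
    next
      assume "u = b"
      then have "v \<in> {a, c, q}" using v uv(2) n' N2 irr by blast
      with \<open>u = b\<close> show ?thesis by blast
    next
      assume "u = c"
      then have "v \<in> {b, d, r}" using v uv(2) N2 irr by blast
      with \<open>u = c\<close> show ?thesis by blast
    next
      assume "u = d"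
      then have "v \<in> {a, c}" using v uv(2) N2 irr by blast
      with \<open>u = d\<close> show ?thesis by blast
    next
      assume "u = p"
      then have "v = a" using v uv(2) n n' irr by blast
      with \<open>u = p\<close> show ?thesis by blast
    next
      assume "u = q"
      then have "v = b" using v uv(2) n n' N2 irr by blast
      with \<open>u = q\<close> show ?thesis by blast
    next
      assume "u = r"
      then have "v = c" using v uv(2) n n' N2 irr by blast
      with \<open>u = r\<close> show ?thesis by blast
    qed
    then show "e' \<in> ?R" using uv(1) by (elim disjE conjE insertE; simp add: insert_commute)
  qed
  moreover have "?R \<subseteq> {e \<in> edges G. e \<subseteq> ?X}"
    using e by (auto simp: edge_iff[OF sym_arcs])
  ultimately show ?thesis unfolding sunspot4_def using dist verts by blast
qed

text \<open>A chord would close a triangle, so the 4-cycle is induced. Hence flaplessness forbids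
  every 4-cycle through an edge of a hole of length at least 6.\<close>

lemma (in graph) four_cycle_hole:
  assumes tf: "triangle_free G"
    and e: "a \<rightarrow>\<^bsub>G\<^esub> b" "b \<rightarrow>\<^bsub>G\<^esub> c" "c \<rightarrow>\<^bsub>G\<^esub> d" "d \<rightarrow>\<^bsub>G\<^esub> a" and ne: "a \<noteq> c" "b \<noteq> d"
  shows "hole G (G \<restriction> {a, b, c, d})"
    and "edges (G \<restriction> {a, b, c, d}) = {{a, b}, {b, c}, {c, d}, {d, a}}"
    and "hole_length (G \<restriction> {a, b, c, d}) = 4"
proof -
  have sym: "u \<rightarrow>\<^bsub>G\<^esub> v \<Longrightarrow> v \<rightarrow>\<^bsub>G\<^esub> u" for u v using arcs_ends_symmetric[OF sym_arcs] .
  have irr: "\<not> u \<rightarrow>\<^bsub>G\<^esub> u" for u using adj_not_same by blast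
  note tri = triangle_freeD[OF tf]
  let ?X = "{a, b, c, d}"
  have dist: "distinct [a, b, c, d]" using e ne irr by auto
  have "?X \<subseteq> verts G" using e adj_in_verts by blast
  then have ind: "induced_subgraph (G \<restriction> ?X) G" by blast
  have n: "\<not> a \<rightarrow>\<^bsub>G\<^esub> c" "\<not> b \<rightarrow>\<^bsub>G\<^esub> d" "\<not> c \<rightarrow>\<^bsub>G\<^esub> a" "\<not> d \<rightarrow>\<^bsub>G\<^esub> b"
    using tri e sym by blast+
  show E: "edges (G \<restriction> ?X) = {{a, b}, {b, c}, {c, d}, {d, a}}"
  proof
    show "edges (G \<restriction> ?X) \<subseteq> {{a, b}, {b, c}, {c, d}, {d, a}}"
    proof
      fix x assume "x \<in> edges (G \<restriction> ?X)"
      then obtain u v where uv: "x = {u, v}" "u \<in> ?X" "v \<in> ?X" "u \<rightarrow>\<^bsub>G\<^esub> v"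
        unfolding edges_def induced_subgraph_adj_iff[OF ind] induce_subgraph_verts by blast
      from uv(2) consider "u \<in> {a, c}" | "u \<in> {b, d}" by blast
      then show "x \<in> {{a, b}, {b, c}, {c, d}, {d, a}}"
      proof cases
        case 1
        then have "v \<in> {b, d}" using uv n irr by blast
        then show ?thesis using 1 uv(1) by (elim insertE emptyE; simp add: insert_commute)
      next
        case 2
        then have "v \<in> {a, c}" using uv n irr by blast
        then show ?thesis using 2 uv(1) by (elim insertE emptyE; simp add: insert_commute)
      qed
    qed
    have "{u, v} \<in> edges (G \<restriction> ?X)" if "u \<in> ?X" "v \<in> ?X" "u \<rightarrow>\<^bsub>G\<^esub> v" for u v
      unfolding edges_def induced_subgraph_adj_iff[OF ind] induce_subgraph_verts
      using that by blast
    then show "{{a, b}, {b, c}, {c, d}, {d, a}} \<subseteq> edges (G \<restriction> ?X)"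
      using e by simp
  qed
  show "hole_length (G \<restriction> ?X) = 4"
    using dist unfolding hole_length_def E by (simp add: card_insert_if doubleton_eq_iff) auto
  have indices: "{F i | i. i < 4} = {F 0, F 1, F 2, F 3}" for F :: "nat \<Rightarrow> 'a set"
    by (auto simp: less_Suc_eq numeral_eq_Suc)
  have "edges (G \<restriction> ?X) = {{[a, b, c, d] ! i, [a, b, c, d] ! (Suc i mod 4)} | i. i < 4}"
    unfolding E indices by (simp add: insert_commute)
  then have "cycle_graph (G \<restriction> ?X)"
    unfolding cycle_graph_def using dist by (intro exI[of _ "[a, b, c, d]"]) auto
  then show "hole G (G \<restriction> ?X)" using ind dist by (simp add: hole_def)
qed

section \<open>Assembling the flare\<close>

theorem theorem3p1:
  fixes G H :: "('a, 'b) pre_digraph" and d :: nat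
  assumes "d \<ge> 1"
    and "graph G"
    and "triangle_free G"
    and "sunspot4_free G"
    and "\<forall>v\<in>verts G. degree G v \<ge> 4 * d - 1"
    and "liberal G"
    and "flapless G"
    and "hole G H"
    and "hole_length H \<ge> 6"
  shows "\<exists>\<Phi>. flare G H \<Phi> \<and> full_flare H \<Phi> \<and> safe_flare d G H \<Phi>"
proof -
  have wf: "wf_digraph G" and fin: "finite (verts G)" and symG: "symmetric G"
    using \<open>graph G\<close>
    by (auto simp: graph_def pseudo_graph_def fin_digraph_def fin_digraph_axioms_def
        sym_digraph_def sym_digraph_axioms_def)
  have sym: "u \<rightarrow>\<^bsub>G\<^esub> v \<Longrightarrow> v \<rightarrow>\<^bsub>G\<^esub> u" for u v using arcs_ends_symmetric[OF symG] .
  have edge: "{u, v} \<in> edges G \<longleftrightarrow> u \<rightarrow>\<^bsub>G\<^esub> v" for u v using edge_iff[OF symG] .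
  have ind: "induced_subgraph H G" and cyc: "cycle_graph H"
    using \<open>hole G H\<close> by (auto simp: hole_def)
  note adjH = induced_subgraph_adj_iff[OF ind]
  have subH: "verts H \<subseteq> verts G" and wfH: "wf_digraph H"
    using ind by (auto simp: induced_subgraph_def subgraph_def)
  have symH: "symmetric H" using induced_graph_imp_symmetric[OF symG ind] .
  obtain n :: int and w :: "int \<Rightarrow> 'a" where nw: "n \<ge> 3" "range w = verts H"
    "\<And>t s. w t = w s \<longleftrightarrow> t mod n = s mod n"
    "\<And>t v. w t \<rightarrow>\<^bsub>H\<^esub> v \<longleftrightarrow> v = w (t + 1) \<or> v = w (t - 1)"
    using cycle_graph_winding[OF cyc symH] by blast
  \<comment> \<open>Closeness by indices is symmetric, easy to count, and covers all pairs at
    distance at most \<open>d\<close>. Indices are fixed only modulo \<open>n\<close>, so some pair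
    of representatives suffices.\<close>
  define near where "near h h' \<longleftrightarrow> (\<exists>t s. h = w t \<and> h' = w s \<and> \<bar>s - t\<bar> \<le> int d)" for h h'
  have rel: "sunspot_free_relation (verts G) (verts H) (\<lambda>u v. u \<rightarrow>\<^bsub>G\<^esub> v)"
  proof
    show "finite (verts G)" by fact
    show "verts H \<subseteq> verts G" by fact
    show "x \<rightarrow>\<^bsub>G\<^esub> y \<Longrightarrow> y \<rightarrow>\<^bsub>G\<^esub> x" for x y by (rule sym)
    show "x \<rightarrow>\<^bsub>G\<^esub> y \<Longrightarrow> y \<in> verts G" for x y using wf_digraph.adj_in_verts[OF wf] by blast
    show False if "x \<rightarrow>\<^bsub>G\<^esub> y" "y \<rightarrow>\<^bsub>G\<^esub> z" "z \<rightarrow>\<^bsub>G\<^esub> x" for x y z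
      using graph.triangle_freeD[OF \<open>graph G\<close> \<open>triangle_free G\<close> that] .
    show False if "a \<rightarrow>\<^bsub>G\<^esub> b" "b \<rightarrow>\<^bsub>G\<^esub> c" "c \<rightarrow>\<^bsub>G\<^esub> e" "e \<rightarrow>\<^bsub>G\<^esub> a" "a \<noteq> c" "b \<noteq> e" "a \<rightarrow>\<^bsub>G\<^esub> p" "b \<rightarrow>\<^bsub>G\<^esub> q" "c \<rightarrow>\<^bsub>G\<^esub> r"
      "\<not> p \<rightarrow>\<^bsub>G\<^esub> q" "\<not> q \<rightarrow>\<^bsub>G\<^esub> r" "\<not> p \<rightarrow>\<^bsub>G\<^esub> r" "\<not> p \<rightarrow>\<^bsub>G\<^esub> c" "\<not> r \<rightarrow>\<^bsub>G\<^esub> a" "\<not> q \<rightarrow>\<^bsub>G\<^esub> e" for a b c e p q r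
      using graph.sunspot4I[OF \<open>graph G\<close> \<open>triangle_free G\<close> that(1-4,7-9,5,6,10-)] \<open>sunspot4_free G\<close>
      unfolding sunspot4_free_def by blast
    show "\<exists>z. x \<rightarrow>\<^bsub>G\<^esub> z \<and> \<not> y \<rightarrow>\<^bsub>G\<^esub> z" if "x \<in> verts G" "y \<in> verts G" "x \<noteq> y" "\<not> x \<rightarrow>\<^bsub>G\<^esub> y" for x y
      using \<open>liberal G\<close> that unfolding liberal_def nbhd_def edge by blast
    show "\<exists>a b. a \<noteq> b \<and> {x \<in> verts H. h \<rightarrow>\<^bsub>G\<^esub> x} = {a, b}" if h: "h \<in> verts H" for h
    proof -
      obtain t where t: "h = w t" using h nw(2) by blast
      have "{x \<in> verts H. h \<rightarrow>\<^bsub>G\<^esub> x} = {x. h \<rightarrow>\<^bsub>H\<^esub> x}" using h adjH by auto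
      also have "\<dots> = {w (t + 1), w (t - 1)}" using nw(4) t by auto
      finally have "{x \<in> verts H. h \<rightarrow>\<^bsub>G\<^esub> x} = {w (t + 1), w (t - 1)}" .
      \<comment> \<open>A period of at least 3 cannot divide 2.\<close>
      moreover have "w (t + 1) \<noteq> w (t - 1)"
      proof
        assume "w (t + 1) = w (t - 1)"
        then have "n dvd (t + 1) - (t - 1)" unfolding nw(3) mod_eq_dvd_iff .
        then show False using nw(1) zdvd_imp_le[of n 2] by simp
      qed
      ultimately show ?thesis by blast
    qed
    show False if "a \<in> verts H" "b \<in> verts H" "a \<rightarrow>\<^bsub>G\<^esub> b" "b \<rightarrow>\<^bsub>G\<^esub> c" "c \<rightarrow>\<^bsub>G\<^esub> e" "e \<rightarrow>\<^bsub>G\<^esub> a" "a \<noteq> c" "b \<noteq> e"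
      for a b c e
    proof -
      note four = graph.four_cycle_hole[OF \<open>graph G\<close> \<open>triangle_free G\<close> that(3-)]
      have "{a, b} \<in> edges H" using edge_iff[OF symH] adjH that by simp
      then have "flap G H (G \<restriction> {a, b, c, e})" unfolding flap_def using four by auto
      then show False
        using \<open>flapless G\<close> \<open>hole G H\<close> \<open>hole_length H \<ge> 6\<close> unfolding flapless_def by blast
    qed
  qed
  have near_card: "card {h' \<in> verts H. near h h' \<and> h' \<noteq> h \<and> \<not> h \<rightarrow>\<^bsub>G\<^esub> h'} \<le> 2 * (d - 1)" (is "card ?C \<le> _")
    if h: "h \<in> verts H" for h
  proof -
    obtain t where t: "h = w t" using h nw(2) by blast
    \<comment> \<open>The window of \<open>2 * d + 1\<close> indices around \<open>t\<close> loses
      \<open>t\<close> and \<open>t + 1\<close>, \<open>t - 1\<close>, which name \<open>h\<close>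
      and its hole neighbours. All three lie in it because \<open>d \<ge> 1\<close>, so
      \<open>2 * (d - 1)\<close> indices remain; repeated vertices only lower the count.\<close>
    let ?I = "{t - int d..t + int d} - {t - 1, t, t + 1}"
    have "?C \<subseteq> w ` ?I"
    proof clarify
      fix h' assume h': "h' \<in> verts H" "near h h'" "h' \<noteq> h" "\<not> h \<rightarrow>\<^bsub>G\<^esub> h'"
      then obtain t' s where s: "h = w t'" "h' = w s" "\<bar>s - t'\<bar> \<le> int d" by (auto simp: near_def)
      \<comment> \<open>Nearness may be witnessed by another index \<open>t'\<close> of
        \<open>h\<close>; its offset is carried over to \<open>t\<close>.\<close>
      have "w (t' + (s - t')) = w (t + (s - t'))"
        unfolding nw(3) by (rule mod_add_cong) (use s(1) t nw(3) in auto)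
      then have eq: "h' = w (t + (s - t'))" using s by simp
      have "t + (s - t') \<notin> {t - 1, t, t + 1}"
        using h' h nw(4)[of t h'] adjH unfolding t eq by auto
      then show "h' \<in> w ` ?I" using eq s(3) by (intro image_eqI[of _ _ "t + (s - t')"]) auto
    qed
    then have "card ?C \<le> card ?I" by (rule surj_card_le[rotated]) simp
    also have "card ?I = card {t - int d..t + int d} - card {t - 1, t, t + 1}"
      using \<open>d \<ge> 1\<close> by (intro card_Diff_subset) auto
    also have "\<dots> = 2 * (d - 1)" by auto
    finally show ?thesis .
  qed
  have near_sym: "near h h' \<Longrightarrow> near h' h" for h h'
    unfolding near_def by (metis abs_minus_commute)
  have deg: "card {x. h \<rightarrow>\<^bsub>G\<^esub> x} \<ge> 4 * d - 1" if "h \<in> verts H" for h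
    using assms(5) that subH by (auto simp: degree_def nbhd_def)
  \<comment> \<open>With \<open>T\<close> the whole hole, the conditions hold for all near
    pairs.\<close>
  from sunspot_free_relation.greedy_choice[OF rel near_sym near_card deg \<open>d \<ge> 1\<close> subset_refl]
  obtain f where f: "\<And>h. h \<in> verts H \<Longrightarrow> h \<rightarrow>\<^bsub>G\<^esub> f h" "\<And>h. h \<in> verts H \<Longrightarrow> f h \<notin> verts H"
    "\<And>h h'. \<lbrakk>h \<in> verts H; h' \<in> verts H; near h h'; h' \<noteq> h\<rbrakk> \<Longrightarrow> \<not> h' \<rightarrow>\<^bsub>G\<^esub> f h"
    "\<And>h h'. \<lbrakk>h \<in> verts H; h' \<in> verts H; near h h'; h' \<noteq> h\<rbrakk> \<Longrightarrow> \<not> f h \<rightarrow>\<^bsub>G\<^esub> f h'"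
    by blast
  define \<Phi> where "\<Phi> h = {f h}" for h
  have "flare G H \<Phi>" using f by (auto simp: flare_def \<Phi>_def nbhd_def)
  moreover have "full_flare H \<Phi>" by (simp add: full_flare_def \<Phi>_def)
  moreover have "safe_flare d G H \<Phi>"
    unfolding safe_flare_def
  proof (intro ballI impI)
    fix h h' assume h: "h \<in> verts H" "h' \<in> verts H" "h \<noteq> h' \<and> gdist H h h' \<le> ereal (real d)"
    \<comment> \<open>A walk of at most \<open>d\<close> arcs, lifted from an index of
      \<open>h\<close>, ends at an index at most \<open>d\<close> away, so \<open>h\<close> and
      \<open>h'\<close> are near.\<close>
    then obtain p where p: "pre_digraph.awalk H h p h'" "length p \<le> d"
      using wf_digraph.gdist_le_imp_awalk[OF wfH] by metis
    obtain t where t: "h = w t" using h nw(2) by blast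
    have "\<exists>s. h' = w s \<and> \<bar>s - t\<bar> \<le> int (length p)"
      by (rule wf_digraph.awalk_winding[OF wfH]) (use nw(4) p t in auto)
    then have near: "near h h'" unfolding near_def using t p(2) by force
    \<comment> \<open>\<open>h'\<close> is adjacent to \<open>f h'\<close> but not to
      \<open>f h\<close>.\<close>
    have "f h \<noteq> f h'" using f(1)[OF h(2)] f(3)[OF h(1,2) near] h(3) by auto
    moreover have "f h \<noteq> h'" using f(2) h by blast
    ultimately show "anticomplete G (\<Phi> h) (insert h' (\<Phi> h'))"
      using f(3)[OF h(1,2) near] f(4)[OF h(1,2) near] h(3) sym
      by (auto simp: anticomplete_def \<Phi>_def edge)
  qed
  ultimately show ?thesis by blast
qed

end
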